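(* $$\lim_{\gamma\to0}R^*_{\gamma,S}(\rho,n)>0 \implies E^*_S(\rho, n)$$ $$\lim_{\gamma\to0}R^*_{\gamma,S}(\rho,n)<0 \implies \neg E^*_S(\rho, n)$$
   Context: A signal $S=(C(t_0),\dots,C(t_{|S|-1}))$ is a finite sequence of samples $S_n\in\mathbb{R}^m$ (vectors of state variables) taken at strictly increasing, arbitrarily spaced time indices $t_0<t_1<\dots$; $\lvert S\rvert$ is the number of samples and $\Delta t_n = t_{n+1}-t_n$. STL constraints are $\rho ::= \mu_{f,c} \mid \neg\rho \mid \rho_1\wedge\rho_2 \mid \square_{[x,y]}\rho \mid \Diamond_{[x,y]}\rho \mid \rho_1\,\mathcal{U}_{[x,y]}\,\rho_2$, where $f$ is a differentiable real-valued function of a sample, $c$ a constant, and $[x,y]$ a temporal window. $n<\lvert S\rvert$ is a sample index. $E^*_S(\rho,n)$ is a recursive boolean semantics (shown equivalent to standard STL semantics): $E^*_S(\mu_{f,c},n)= f(S_n)>c$; negation and conjunction are boolean. For temporal operators, with the "terminal" case being $n=\lvert S\rvert-1 \vee y-\Delta t_n<0$ and the "recursive" case $n<\lvert S\rvert-1$ (otherwise), and writing the shifted window $[x-\Delta t_n, y-\Delta t_n]$: - $E^*_S(\Diamond_{[x,y]}\rho,n)$: terminal: $x\le 0\wedge E^*_S(\rho,n)$; recursive: $(x\le0\wedge E^*_S(\rho,n))\vee E^*_S(\Diamond_{[x-\Delta t_n,y-\Delta t_n]}\rho,n+1)$. - $E^*_S(\square_{[x,y]}\rho,n)$: terminal: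 $x\le 0\wedge E^*_S(\rho,n)$; recursive: $(x>0\vee E^*_S(\rho,n))\wedge E^*_S(\square_{[x-\Delta t_n,y-\Delta t_n]}\rho,n+1)$. - $E^*_S(\rho_1\mathcal{U}_{[x,y]}\rho_2,n)$: terminal: $x\le0\wedge E^*_S(\rho_1\wedge\rho_2,n)$; recursive: $\bigl((x>0\vee E^*_S(\rho_1,n))\wedge E^*_S(\rho_1\mathcal{U}_{[x-\Delta t_n,y-\Delta t_n]}\rho_2,n+1)\bigr)\vee(x\le0\wedge E^*_S(\rho_1\wedge\rho_2,n))$. Smooth max/min with parameter $\gamma$: $\max_\gamma(a,b)=\max\{a,b\}$ if $\gamma\le0$, $\gamma\ln(e^{a/\gamma}+e^{b/\gamma})$ if $\gamma>0$; $\min_\gamma(a,b)=\min\{a,b\}$ if $\gamma\le0$, $-\max_\gamma(-a,-b)$ if $\gamma>0$. $R^*_{\gamma,S}(\rho,n)$ is the smooth robustness obtained from $E^*$ by replacing each disjunction with $\max_\gamma$, each conjunction with $\min_\gamma$, each check $x\le0$ with $-x$ and each check $x>0$ with $x$; atomic constraints give $f(S_n)-c$ and negation gives $-R^*$. For example, $R^*_{\gamma,S}(\square_{[x,y]}\rho,n)=\min_\gamma(-x,R^*_{\gamma,S}(\rho,n))$ in the terminal case and $\min_\gamma\bigl(\max_\gamma(x,R^*_{\gamma,S}(\rho,n)),\,R^*_{\gamma,S}(\square_{[x-\Delta t_n,y-\Delta t_n]}\rho,n+1)\bigr)$ in the recursive case. *)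

theory Defs
  imports "HOL-Analysis.Analysis"
begin

(* A sample carries its time index; the samples themselves are vectors in R^m. *)
type_synonym 'm signal = "(real \<times> (real ^ 'm)) list"

definition is_signal :: "'m::finite signal \<Rightarrow> bool" where
  "is_signal S \<longleftrightarrow> sorted_wrt (<) (map fst S)"

definition sample :: "'m::finite signal \<Rightarrow> nat \<Rightarrow> real ^ 'm" where
  "sample S n = snd (S ! n)"

definition dt :: "'m::finite signal \<Rightarrow> nat \<Rightarrow> real" where
  "dt S n = fst (S ! (n + 1)) - fst (S ! n)"

datatype 'm::finite stl =
    Atom "real ^ 'm \<Rightarrow> real" real
  | Neg "'m stl"
  | And "'m stl" "'m stl"
  | Always real real "'m stl"
  | Eventually real real "'m stl"
  | Until real real "'m stl" "'m stl"

primrec differentiable_atoms :: "'m::finite stl \<Rightarrow> bool" where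
  "differentiable_atoms (Atom f c) \<longleftrightarrow> (\<forall>v. f differentiable (at v))"
| "differentiable_atoms (Neg \<rho>) \<longleftrightarrow> differentiable_atoms \<rho>"
| "differentiable_atoms (And \<rho>1 \<rho>2) \<longleftrightarrow> differentiable_atoms \<rho>1 \<and> differentiable_atoms \<rho>2"
| "differentiable_atoms (Always x y \<rho>) \<longleftrightarrow> differentiable_atoms \<rho>"
| "differentiable_atoms (Eventually x y \<rho>) \<longleftrightarrow> differentiable_atoms \<rho>"
| "differentiable_atoms (Until x y \<rho>1 \<rho>2) \<longleftrightarrow> differentiable_atoms \<rho>1 \<and> differentiable_atoms \<rho>2"

(* For n < length S the first disjunct says n = length S - 1. With \<ge> in place of = the
   recursions below are total; their values at indices n \<ge> length S are irrelevant.
   At the last index dt is meaningless, but the first disjunct then decides. *)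
definition terminal :: "'m::finite signal \<Rightarrow> real \<Rightarrow> nat \<Rightarrow> bool" where
  "terminal S y n \<longleftrightarrow> n \<ge> length S - 1 \<or> y - dt S n < 0"

(* Until and the conjunction of its arguments have the same size; this breaks the tie in the
   termination orders. *)
primrec until_rank :: "'m::finite stl \<Rightarrow> nat" where
  "until_rank (Atom f c) = 0"
| "until_rank (Neg \<rho>) = 0"
| "until_rank (And \<rho>1 \<rho>2) = 0"
| "until_rank (Always x y \<rho>) = 0"
| "until_rank (Eventually x y \<rho>) = 0"
| "until_rank (Until x y \<rho>1 \<rho>2) = 1"

function E :: "'m::finite signal \<Rightarrow> 'm stl \<Rightarrow> nat \<Rightarrow> bool" where
  "E S (Atom f c) n \<longleftrightarrow> f (sample S n) > c"
| "E S (Neg \<rho>) n \<longleftrightarrow> \<not> E S \<rho> n"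
| "E S (And \<rho>1 \<rho>2) n \<longleftrightarrow> E S \<rho>1 n \<and> E S \<rho>2 n"
| "E S (Always x y \<rho>) n \<longleftrightarrow>
     (if terminal S y n then x \<le> 0 \<and> E S \<rho> n
      else (x > 0 \<or> E S \<rho> n) \<and> E S (Always (x - dt S n) (y - dt S n) \<rho>) (n + 1))"
| "E S (Eventually x y \<rho>) n \<longleftrightarrow>
     (if terminal S y n then x \<le> 0 \<and> E S \<rho> n
      else (x \<le> 0 \<and> E S \<rho> n) \<or> E S (Eventually (x - dt S n) (y - dt S n) \<rho>) (n + 1))"
| "E S (Until x y \<rho>1 \<rho>2) n \<longleftrightarrow>
     (if terminal S y n then x \<le> 0 \<and> E S (And \<rho>1 \<rho>2) n
      else ((x > 0 \<or> E S \<rho>1 n) \<and> E S (Until (x - dt S n) (y - dt S n) \<rho>1 \<rho>2) (n + 1))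
           \<or> (x \<le> 0 \<and> E S (And \<rho>1 \<rho>2) n))"
  by pat_completeness auto
termination
  by (relation "measures [\<lambda>(S, \<rho>, n). size \<rho>, \<lambda>(S, \<rho>, n). until_rank \<rho>,
        \<lambda>(S, \<rho>, n). length S - n]")
     (auto simp: terminal_def)

definition smax :: "real \<Rightarrow> real \<Rightarrow> real \<Rightarrow> real" where
  "smax \<gamma> a b = (if \<gamma> \<le> 0 then max a b else \<gamma> * ln (exp (a / \<gamma>) + exp (b / \<gamma>)))"

definition smin :: "real \<Rightarrow> real \<Rightarrow> real \<Rightarrow> real" where
  "smin \<gamma> a b = (if \<gamma> \<le> 0 then min a b else - smax \<gamma> (- a) (- b))"

function R :: "real \<Rightarrow> 'm::finite signal \<Rightarrow> 'm stl \<Rightarrow> nat \<Rightarrow> real" where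
  "R \<gamma> S (Atom f c) n = f (sample S n) - c"
| "R \<gamma> S (Neg \<rho>) n = - R \<gamma> S \<rho> n"
| "R \<gamma> S (And \<rho>1 \<rho>2) n = smin \<gamma> (R \<gamma> S \<rho>1 n) (R \<gamma> S \<rho>2 n)"
| "R \<gamma> S (Always x y \<rho>) n =
     (if terminal S y n then smin \<gamma> (- x) (R \<gamma> S \<rho> n)
      else smin \<gamma> (smax \<gamma> x (R \<gamma> S \<rho> n))
                  (R \<gamma> S (Always (x - dt S n) (y - dt S n) \<rho>) (n + 1)))"
| "R \<gamma> S (Eventually x y \<rho>) n =
     (if terminal S y n then smin \<gamma> (- x) (R \<gamma> S \<rho> n)
      else smax \<gamma> (smin \<gamma> (- x) (R \<gamma> S \<rho> n))
                  (R \<gamma> S (Eventually (x - dt S n) (y - dt S n) \<rho>) (n + 1)))"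
| "R \<gamma> S (Until x y \<rho>1 \<rho>2) n =
     (if terminal S y n then smin \<gamma> (- x) (R \<gamma> S (And \<rho>1 \<rho>2) n)
      else smax \<gamma>
             (smin \<gamma> (smax \<gamma> x (R \<gamma> S \<rho>1 n))
                     (R \<gamma> S (Until (x - dt S n) (y - dt S n) \<rho>1 \<rho>2) (n + 1)))
             (smin \<gamma> (- x) (R \<gamma> S (And \<rho>1 \<rho>2) n)))"
  by pat_completeness auto
termination
  by (relation "measures [\<lambda>(\<gamma>, S, \<rho>, n). size \<rho>, \<lambda>(\<gamma>, S, \<rho>, n). until_rank \<rho>,
        \<lambda>(\<gamma>, S, \<rho>, n). length S - n]")
     (auto simp: terminal_def)

end

(* The limit is the value at \<gamma> = 0: smax \<gamma> exceeds max by at most \<gamma> ln 2, so smax and smin are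
   jointly continuous at \<gamma> = 0 and R \<gamma> S \<rho> n tends to R 0 S \<rho> n by induction on the recursion.
   At \<gamma> = 0 the robustness is a min/max expression, whose strict sign decides each boolean. *)
theory Submission
  imports Defs
begin

text \<open>One of the two exponentials is \<open>exp (max a b / \<gamma>)\<close> and the other is
  positive.\<close>

lemma smax_ge_max: "max a b \<le> smax \<gamma> a b"
proof (cases "\<gamma> \<le> 0")
  case False
  then have "max a b = \<gamma> * ln (exp (max a b / \<gamma>))"
    by simp
  also have "\<dots> \<le> \<gamma> * ln (exp (a / \<gamma>) + exp (b / \<gamma>))"
    using False by (intro mult_left_mono ln_mono) (auto simp: max_def add_pos_pos)
  finally show ?thesis
    using False by (simp add: smax_def)
qed (simp add: smax_def)

text \<open>Both exponentials are at most \<open>exp (max a b / \<gamma>)\<close>. The absolute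
  value keeps the error term nonnegative for \<gamma> \<le> 0, so the bound serves a two-sided
  limit.\<close>

lemma smax_le_max: "smax \<gamma> a b \<le> max a b + \<bar>\<gamma>\<bar> * ln 2"
proof (cases "\<gamma> \<le> 0")
  case False
  have "smax \<gamma> a b \<le> \<gamma> * ln (2 * exp (max a b / \<gamma>))"
  proof -
    have "exp (a / \<gamma>) \<le> exp (max a b / \<gamma>)" "exp (b / \<gamma>) \<le> exp (max a b / \<gamma>)"
      using False by (auto intro: divide_right_mono)
    then have "exp (a / \<gamma>) + exp (b / \<gamma>) \<le> 2 * exp (max a b / \<gamma>)"
      by linarith
    then show ?thesis
      using False by (simp add: smax_def add_pos_pos ln_mono)
  qed
  also have "\<dots> = max a b + \<bar>\<gamma>\<bar> * ln 2"
    using False by (simp add: ln_mult algebra_simps)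
  finally show ?thesis .
next
  case True
  then have "0 \<le> \<bar>\<gamma>\<bar> * ln 2"
    by (intro mult_nonneg_nonneg) auto
  with True show ?thesis
    unfolding smax_def by (simp only: if_True)
qed

text \<open>The arguments vary with \<gamma> because nested robustness values do; the two bounds
  above squeeze \<open>smax\<close>.\<close>

lemma tendsto_smax:
  assumes "(f \<longlongrightarrow> a) (at 0)" and "(g \<longlongrightarrow> b) (at 0)"
  shows "((\<lambda>\<gamma>. smax \<gamma> (f \<gamma>) (g \<gamma>)) \<longlongrightarrow> smax 0 a b) (at 0)"
proof (rule tendsto_sandwich)
  have lim: "((\<lambda>\<gamma>. max (f \<gamma>) (g \<gamma>)) \<longlongrightarrow> max a b) (at 0)"
    using assms by (rule tendsto_max)
  then show "((\<lambda>\<gamma>. max (f \<gamma>) (g \<gamma>)) \<longlongrightarrow> smax 0 a b) (at 0)"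
    by (simp add: smax_def)
  have "((\<lambda>\<gamma>. max (f \<gamma>) (g \<gamma>) + \<bar>\<gamma>\<bar> * ln 2) \<longlongrightarrow> max a b + \<bar>0\<bar> * ln 2) (at 0)"
    by (intro tendsto_intros lim)
  then show "((\<lambda>\<gamma>. max (f \<gamma>) (g \<gamma>) + \<bar>\<gamma>\<bar> * ln 2) \<longlongrightarrow> smax 0 a b) (at 0)"
    by (simp add: smax_def)
qed (intro always_eventually allI smax_ge_max smax_le_max)+

lemma smin_eq_uminus_smax: "smin \<gamma> a b = - smax \<gamma> (- a) (- b)"
  by (auto simp: smin_def smax_def)

lemma tendsto_smin:
  assumes "(f \<longlongrightarrow> a) (at 0)" and "(g \<longlongrightarrow> b) (at 0)"
  shows "((\<lambda>\<gamma>. smin \<gamma> (f \<gamma>) (g \<gamma>)) \<longlongrightarrow> smin 0 a b) (at 0)"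
  unfolding smin_eq_uminus_smax using assms by (intro tendsto_minus tendsto_smax)

text \<open>\<open>E\<close> makes the same recursive calls as \<open>R\<close> but has no \<gamma>,
  which is bound in the claim; hence its induction rule.\<close>

lemma tendsto_R: "((\<lambda>\<gamma>. R \<gamma> S \<rho> n) \<longlongrightarrow> R 0 S \<rho> n) (at 0)"
proof (induction S \<rho> n rule: E.induct)
  case (4 S x y \<rho> n)
  then show ?case
    \<comment> \<open>Fixing all arguments except \<gamma> unfolds one level only, so the recursive
      call still matches the induction hypothesis.\<close>
    by (cases "terminal S y n") (simp_all only: R.simps(4)[of _ S x y \<rho> n] if_True if_False
      tendsto_smax tendsto_smin tendsto_const simp_thms)
next
  case (5 S x y \<rho> n)
  then show ?case
    by (cases "terminal S y n") (simp_all only: R.simps(5)[of _ S x y \<rho> n] if_True if_False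
      tendsto_smax tendsto_smin tendsto_const simp_thms)
next
  case (6 S x y \<rho>1 \<rho>2 n)
  then show ?case
    by (cases "terminal S y n") (simp_all only: R.simps(6)[of _ S x y \<rho>1 \<rho>2 n] if_True if_False
      tendsto_smax tendsto_smin tendsto_const simp_thms)
qed (simp_all add: tendsto_smin tendsto_minus)

text \<open>Both implications go through one induction because \<open>Neg\<close> swaps them. The
  value 0 decides nothing: at f = c an atom is false but its negation is true.\<close>

lemma R_0_sign: "(R 0 S \<rho> n > 0 \<longrightarrow> E S \<rho> n) \<and> (R 0 S \<rho> n < 0 \<longrightarrow> \<not> E S \<rho> n)"
proof (induction S \<rho> n rule: E.induct)
  case (4 S x y \<rho> n)
  then show ?case
    unfolding R.simps(4)[of _ S x y \<rho> n] E.simps(4)[of S x y \<rho> n] smax_def smin_def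
    by (auto simp del: R.simps E.simps)
next
  case (5 S x y \<rho> n)
  then show ?case
    unfolding R.simps(5)[of _ S x y \<rho> n] E.simps(5)[of S x y \<rho> n] smax_def smin_def
    by (auto simp del: R.simps E.simps)
next
  case (6 S x y \<rho>1 \<rho>2 n)
  then show ?case
    unfolding R.simps(6)[of _ S x y \<rho>1 \<rho>2 n] E.simps(6)[of S x y \<rho>1 \<rho>2 n] smax_def smin_def
    by (auto simp del: R.simps E.simps)
qed (auto simp: smin_def)

text \<open>\<open>Lim\<close> is total, so existence of the limit is asserted separately.\<close>

theorem theorem1:
  fixes S :: "'m::finite signal" and \<rho> :: "'m stl" and n :: nat
  assumes "is_signal S"
    and "differentiable_atoms \<rho>"
    and "n < length S"
  shows "(\<exists>L. ((\<lambda>\<gamma>. R \<gamma> S \<rho> n) \<longlongrightarrow> L) (at 0)) \<and>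
         (Lim (at 0) (\<lambda>\<gamma>. R \<gamma> S \<rho> n) > 0 \<longrightarrow> E S \<rho> n) \<and>
         (Lim (at 0) (\<lambda>\<gamma>. R \<gamma> S \<rho> n) < 0 \<longrightarrow> \<not> E S \<rho> n)"
proof -
  have "Lim (at 0) (\<lambda>\<gamma>. R \<gamma> S \<rho> n) = R 0 S \<rho> n"
    \<comment> \<open>Left to \<open>simp\<close>: the filter \<open>at 0\<close> is nontrivial, so
      limits are unique.\<close>
    by (rule tendsto_Lim[OF _ tendsto_R]) simp
  then show ?thesis
    using tendsto_R R_0_sign by metis
qed

end
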